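(* Suppose that each $P\in\mathcal{P}$ is supported and that $\mathcal{P}$ is countably convex. For any $S\in\mathcal{S}$, the following are equivalent: (i) $\operatorname{NA}(\mathcal{P},S)$ holds. (ii) For all $P\in\mathcal{P}$ there exists $Q\in\mathfrak{M}_\approx(S)$ such that $P\ll Q$.
   Context: $(\Omega,\mathcal{F})$ is a measurable space and $\mathcal{P}$ is a non-empty set of probability measures on it; $c(A):=\sup_{P\in\mathcal{P}}P(A)$ for $A\in\mathcal{F}$. An event $A\in\mathcal{F}$ is $\mathcal{P}$-polar if $c(A)=0$; a property holds $\mathcal{P}$-q.s. if it holds outside a $\mathcal{P}$-polar event. $\mathfrak{P}_c(\Omega)$ is the set of probability measures on $(\Omega,\mathcal{F})$ vanishing on all $\mathcal{P}$-polar events. $Q\in\mathfrak{P}_c(\Omega)$ is supported if there is $S(Q)\in\mathcal{F}$ such that $Q(S(Q)^c)=0$ and, whenever $N\in\mathcal{F}$ satisfies $Q(N)=0$, $N\cap S(Q)$ is $\mathcal{P}$-polar. $\mathcal{P}$ is countably convex if $\sum_{n\in\mathbb{N}}\alpha_nP_n\in\mathcal{P}$ whenever $P_n\in\mathcal{P}$ for all $n\in\mathbb{N}$ and $(\alpha_n)_{n\in\mathbb{N}}$ are non-negative reals summing to $1$. A one-period market model of dimension $d\in\mathbb{N}$ is $S=(S_0,S_1)$ with $S_0\in\mathbb{R}^d$ and $S_1$ a bounded $d$-dimensional random vector on $(\Omega,\mathcal{F})$, all coordinates of $S_0,S_1$ being non-negative; $\mathcal{S}$ is the collection of all such models of all dimensions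 $d\in\mathbb{N}$; $d(S)$ is the dimension of $S$; $\Delta S:=S_1-S_0$; for $H\in\mathbb{R}^{d(S)}$, $H\Delta S$ is the ($\omega$-wise) Euclidean scalar product. $\operatorname{NA}(\mathcal{P},S)$ holds if for all $H\in\mathbb{R}^{d(S)}$, $H\Delta S\ge0$ $\mathcal{P}$-q.s. implies $H\Delta S=0$ $\mathcal{P}$-q.s. $\mathfrak{M}(S):=\{Q\in\mathfrak{P}_c(\Omega)\mid E_Q[\Delta S^i]=0\text{ for all }i=1,\dots,d(S)\}$ and $\mathfrak{M}_\approx(S):=\{Q\in\mathfrak{M}(S)\mid\exists P\in\mathcal{P}\colon Q\approx P\}$, where $\approx$ means mutual absolute continuity. *)

theory Defs
  imports "HOL-Probability.Probability"
begin

text \<open>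
  The measurable space is represented by a measure \<open>M\<close> of which only \<^term>\<open>space M\<close> and
  \<^term>\<open>sets M\<close> are used. The probability measures on it are the elements of
  \<^term>\<open>space (prob_algebra M)\<close>.
\<close>

definition capacity :: "'a measure set \<Rightarrow> 'a set \<Rightarrow> ennreal" where
  "capacity PP A = (SUP P\<in>PP. emeasure P A)"

definition polar :: "'a measure \<Rightarrow> 'a measure set \<Rightarrow> 'a set \<Rightarrow> bool" where
  "polar M PP A \<longleftrightarrow> A \<in> sets M \<and> capacity PP A = 0"

definition quasi_surely :: "'a measure \<Rightarrow> 'a measure set \<Rightarrow> ('a \<Rightarrow> bool) \<Rightarrow> bool" where
  "quasi_surely M PP \<phi> \<longleftrightarrow> (\<exists>N. polar M PP N \<and> (\<forall>\<omega>\<in>space M - N. \<phi> \<omega>))"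

definition prob_c :: "'a measure \<Rightarrow> 'a measure set \<Rightarrow> 'a measure set" where
  "prob_c M PP =
     {Q \<in> space (prob_algebra M). \<forall>N. polar M PP N \<longrightarrow> emeasure Q N = 0}"

definition supported :: "'a measure \<Rightarrow> 'a measure set \<Rightarrow> 'a measure \<Rightarrow> bool" where
  "supported M PP Q \<longleftrightarrow>
     Q \<in> prob_c M PP \<and>
     (\<exists>T\<in>sets M. emeasure Q (space M - T) = 0 \<and>
        (\<forall>N\<in>sets M. emeasure Q N = 0 \<longrightarrow> polar M PP (N \<inter> T)))"

definition mixture :: "'a measure \<Rightarrow> (nat \<Rightarrow> real) \<Rightarrow> (nat \<Rightarrow> 'a measure) \<Rightarrow> 'a measure" where
  "mixture M \<alpha> P =
     measure_of (space M) (sets M) (\<lambda>A. \<Sum>n. ennreal (\<alpha> n) * emeasure (P n) A)"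

lemma sets_mixture: "sets (mixture M \<alpha> P) = sets M"
  by (simp add: mixture_def)

lemma emeasure_mixture:
  assumes "\<And>n. sets (P n) = sets M" and "A \<in> sets M"
  shows "emeasure (mixture M \<alpha> P) A = (\<Sum>n. ennreal (\<alpha> n) * emeasure (P n) A)"
  using mixture_def
proof (rule emeasure_measure_of)
  show "sets M \<subseteq> Pow (space M)"
    by (rule sets.space_closed)
  show "A \<in> sets (mixture M \<alpha> P)"
    using assms(2) by (simp add: sets_mixture)
  show "positive (sets (mixture M \<alpha> P)) (\<lambda>A. \<Sum>n. ennreal (\<alpha> n) * emeasure (P n) A)"
    by (simp add: positive_def)
  show "countably_additive (sets (mixture M \<alpha> P))
          (\<lambda>A. \<Sum>n. ennreal (\<alpha> n) * emeasure (P n) A)"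
  proof (rule countably_additiveI)
    fix B :: "nat \<Rightarrow> 'a set"
    assume B: "range B \<subseteq> sets (mixture M \<alpha> P)" "disjoint_family B"
    have "(\<Sum>i. \<Sum>n. ennreal (\<alpha> n) * emeasure (P n) (B i))
        = (\<Sum>n. \<Sum>i. ennreal (\<alpha> n) * emeasure (P n) (B i))"
      using nn_integral_suminf[of "\<lambda>i n. ennreal (\<alpha> n) * emeasure (P n) (B i)"
          "count_space (UNIV :: nat set)"]
      by (simp only: nn_integral_count_space_nat) simp
    also have "\<dots> = (\<Sum>n. ennreal (\<alpha> n) * emeasure (P n) (\<Union>i. B i))"
      using B assms(1) by (simp add: sets_mixture suminf_emeasure)
    finally show "(\<Sum>i. \<Sum>n. ennreal (\<alpha> n) * emeasure (P n) (B i))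
        = (\<Sum>n. ennreal (\<alpha> n) * emeasure (P n) (\<Union>i. B i))" .
  qed
qed

definition countably_convex :: "'a measure \<Rightarrow> 'a measure set \<Rightarrow> bool" where
  "countably_convex M PP \<longleftrightarrow>
     (\<forall>\<alpha> P. (\<forall>n. P n \<in> PP) \<and> (\<forall>n. 0 \<le> \<alpha> n) \<and> \<alpha> sums 1 \<longrightarrow> mixture M \<alpha> P \<in> PP)"

text \<open>
  A model is a pair \<open>(S\<^sub>0, S\<^sub>1)\<close>; its dimension is the cardinality of the index type \<open>'d\<close>, so a
  statement polymorphic in \<open>'d\<close> covers the models of every dimension \<open>d \<ge> 1\<close>.
\<close>

type_synonym ('a, 'd) market = "(real ^ 'd) \<times> ('a \<Rightarrow> real ^ 'd)"

definition market_models :: "'a measure \<Rightarrow> ('a, 'd::finite) market set" where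
  "market_models M =
     {(S0, S1). (\<forall>i. 0 \<le> S0 $ i) \<and> S1 \<in> borel_measurable M \<and> bounded (S1 ` space M) \<and>
        (\<forall>\<omega>\<in>space M. \<forall>i. 0 \<le> S1 \<omega> $ i)}"

definition increment :: "('a, 'd::finite) market \<Rightarrow> 'a \<Rightarrow> real ^ 'd" where
  "increment S \<omega> = snd S \<omega> - fst S"

definition no_arbitrage :: "'a measure \<Rightarrow> 'a measure set \<Rightarrow> ('a, 'd::finite) market \<Rightarrow> bool" where
  "no_arbitrage M PP S \<longleftrightarrow>
     (\<forall>H. quasi_surely M PP (\<lambda>\<omega>. 0 \<le> H \<bullet> increment S \<omega>) \<longrightarrow>
          quasi_surely M PP (\<lambda>\<omega>. H \<bullet> increment S \<omega> = 0))"

definition martingale_measures ::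
    "'a measure \<Rightarrow> 'a measure set \<Rightarrow> ('a, 'd::finite) market \<Rightarrow> 'a measure set" where
  "martingale_measures M PP S = {Q \<in> prob_c M PP. \<forall>i. (\<integral>\<omega>. increment S \<omega> $ i \<partial>Q) = 0}"

text \<open>
  Note the argument order: \<^term>\<open>absolutely_continuous Q P\<close> means that \<open>P\<close> is absolutely
  continuous with respect to \<open>Q\<close>.
\<close>

definition equiv_martingale_measures ::
    "'a measure \<Rightarrow> 'a measure set \<Rightarrow> ('a, 'd::finite) market \<Rightarrow> 'a measure set" where
  "equiv_martingale_measures M PP S =
     {Q \<in> martingale_measures M PP S.
        \<exists>P\<in>PP. absolutely_continuous Q P \<and> absolutely_continuous P Q}"

end

theory Submission
  imports Defs
begin

text \<open>
  The implication from martingale measures to absence of arbitrage integrates a non-negative gain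
  \<open>H \<Delta>S\<close> under a martingale measure \<open>Q\<close> dominating a given \<open>P\<close>: its mean is zero, so it
  vanishes \<open>Q\<close>-almost surely and hence \<open>P\<close>-almost surely.

  The converse reduces the family of models to a single measure. For every \<open>P\<close>, the strategies
  whose gain is \<open>P\<close>-almost surely non-negative form a closed set, and the strategies with
  quasi-surely non-negative gain are the intersection of these sets. As Euclidean space is a
  Lindelof space, countably many measures already determine this intersection. A mixture \<open>R\<close> of
  them and of a prescribed \<open>P\<close> with positive weights belongs to the family by countable convexity,
  dominates \<open>P\<close>, and gives non-negativity \<open>R\<close>-almost surely the same meaning as quasi-surely
  (\<open>ex_dominating_measure\<close>). So quasi-sure absence of arbitrage becomes ordinary absence of arbitrage
  under \<open>R\<close>. The one-period fundamental theorem of asset pricing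
  (\<open>one_period_martingale_density\<close>) then provides a martingale measure equivalent to \<open>R\<close>.
\<close>

section \<open>Quasi-sure properties\<close>

lemma polar_iff: "polar M PP A \<longleftrightarrow> A \<in> sets M \<and> (\<forall>P\<in>PP. emeasure P A = 0)"
proof -
  have "(SUP P\<in>PP. emeasure P A) = 0 \<longleftrightarrow> (\<forall>P\<in>PP. emeasure P A = 0)"
    using SUP_eq_iff[of PP 0 "\<lambda>P. emeasure P A"] by (auto simp: bot_ennreal[symmetric])
  then show ?thesis by (simp add: polar_def capacity_def)
qed

text \<open>
  The exceptional sets may depend on the measure here: when \<open>\<phi>\<close> is measurable, the set on which it
  fails serves as a common one.
\<close>

lemma quasi_surely_iff_AE:
  assumes sets: "\<And>P. P \<in> PP \<Longrightarrow> sets P = sets M"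
    and meas: "{\<omega> \<in> space M. \<phi> \<omega>} \<in> sets M"
  shows "quasi_surely M PP \<phi> \<longleftrightarrow> (\<forall>P\<in>PP. AE \<omega> in P. \<phi> \<omega>)"
proof
  assume "quasi_surely M PP \<phi>"
  then obtain N where N: "polar M PP N" "\<forall>\<omega>\<in>space M - N. \<phi> \<omega>"
    by (auto simp: quasi_surely_def)
  show "\<forall>P\<in>PP. AE \<omega> in P. \<phi> \<omega>"
  proof
    fix P assume P: "P \<in> PP"
    have "space P = space M" using sets[OF P] by (rule sets_eq_imp_space_eq)
    then show "AE \<omega> in P. \<phi> \<omega>"
      using N P sets[OF P] by (intro AE_I[of _ _ N]) (auto simp: polar_iff)
  qed
next
  assume ae: "\<forall>P\<in>PP. AE \<omega> in P. \<phi> \<omega>"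
  let ?N = "space M - {\<omega> \<in> space M. \<phi> \<omega>}"
  have N: "?N \<in> sets M" using meas by auto
  have "emeasure P ?N = 0" if P: "P \<in> PP" for P
  proof -
    have "space P = space M" using sets[OF P] by (rule sets_eq_imp_space_eq)
    moreover have "?N = {\<omega> \<in> space M. \<not> \<phi> \<omega>}" by auto
    ultimately show ?thesis
      using ae P N sets[OF P] by (subst AE_iff_measurable[symmetric, of ?N P \<phi>]) auto
  qed
  then show "quasi_surely M PP \<phi>"
    unfolding quasi_surely_def polar_iff using N by (intro exI[of _ ?N]) auto
qed

lemma AE_absolutely_continuous:
  assumes "absolutely_continuous P Q" "sets P = sets Q" "AE \<omega> in P. \<phi> \<omega>"
  shows "AE \<omega> in Q. \<phi> \<omega>"
  using absolutely_continuous_AE[of Q P \<phi>] assms by simp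

section \<open>A single measure that detects all arbitrages\<close>

lemma closed_AE_nonneg_strategies:
  fixes X :: "'a \<Rightarrow> 'b::euclidean_space"
  shows "closed {H. AE \<omega> in P. 0 \<le> H \<bullet> X \<omega>}"
  unfolding closed_sequential_limits
proof (intro allI impI, elim conjE)
  fix h :: "nat \<Rightarrow> 'b" and l
  assume "\<forall>n. h n \<in> {H. AE \<omega> in P. 0 \<le> H \<bullet> X \<omega>}" and lim: "h \<longlonglongrightarrow> l"
  then have "AE \<omega> in P. \<forall>n. 0 \<le> h n \<bullet> X \<omega>"
    by (simp add: AE_all_countable)
  then have "AE \<omega> in P. 0 \<le> l \<bullet> X \<omega>"
  proof eventually_elim
    case (elim \<omega>)
    have "(\<lambda>n. h n \<bullet> X \<omega>) \<longlonglongrightarrow> l \<bullet> X \<omega>" using lim by (intro tendsto_intros)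
    then show ?case using elim by (intro LIMSEQ_le_const) auto
  qed
  then show "l \<in> {H. AE \<omega> in P. 0 \<le> H \<bullet> X \<omega>}" by simp
qed

lemma absolutely_continuous_mixture:
  assumes "\<And>n. sets (P n) = sets M" and "\<And>n. 0 < \<alpha> n"
  shows "absolutely_continuous (mixture M \<alpha> P) (P n)"
proof -
  have "emeasure (P n) A = 0" if "A \<in> sets M" "emeasure (mixture M \<alpha> P) A = 0" for A
  proof -
    have "(\<Sum>n. ennreal (\<alpha> n) * emeasure (P n) A) = 0"
      using that emeasure_mixture[OF assms(1)] by simp
    then have "ennreal (\<alpha> n) * emeasure (P n) A = 0"
      by (subst (asm) suminf_eq_zero_iff) auto
    then show ?thesis using assms(2)[of n] by (auto simp: ennreal_eq_0_iff)
  qed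
  then show ?thesis
    using assms(1) by (auto simp: absolutely_continuous_def null_sets_def sets_mixture)
qed

text \<open>
  The complements of the closed sets of \<open>P\<close>-almost surely non-negative strategies form an open
  cover, from which a countable subcover is selected; the mixture of the corresponding measures
  with the given \<open>P\<close> is the witness.
\<close>

lemma ex_dominating_measure:
  fixes X :: "'a \<Rightarrow> 'b::euclidean_space"
  assumes sets: "\<And>P. P \<in> PP \<Longrightarrow> sets P = sets M"
    and conv: "countably_convex M PP" and P: "P \<in> PP"
  obtains R where "R \<in> PP" "absolutely_continuous R P"
    "\<And>H P'. AE \<omega> in R. 0 \<le> H \<bullet> X \<omega> \<Longrightarrow> P' \<in> PP \<Longrightarrow> AE \<omega> in P'. 0 \<le> H \<bullet> X \<omega>"
proof -
  define U where "U P' = - {H. AE \<omega> in P'. 0 \<le> H \<bullet> X \<omega>}" for P'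
  have "\<And>V. V \<in> U ` PP \<Longrightarrow> open V"
    using closed_AE_nonneg_strategies by (auto simp: U_def open_Compl)
  then obtain F where F: "F \<subseteq> U ` PP" "countable F" "\<Union>F = \<Union>(U ` PP)"
    by (rule Lindelof)
  then obtain D where D: "countable D" "D \<subseteq> PP" "F = U ` D"
    using countable_subset_image[of F U PP] by auto
  define E where "E = insert P D"
  have E: "countable E" "E \<noteq> {}" "E \<subseteq> PP" using D P by (auto simp: E_def)
  let ?p = "from_nat_into E" and ?\<alpha> = "\<lambda>n. (1/2 :: real) ^ Suc n"
  have p: "?p n \<in> PP" for n using from_nat_into[OF E(2)] E(3) by auto
  let ?R = "mixture M ?\<alpha> ?p"
  have R: "?R \<in> PP"
    using conv p power_half_series unfolding countably_convex_def by auto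
  have dom: "absolutely_continuous ?R P'" if "P' \<in> E" for P'
  proof -
    obtain n where "?p n = P'"
      using \<open>P' \<in> E\<close> E range_from_nat_into[of E] by (metis rangeE)
    then show ?thesis
      using absolutely_continuous_mixture[of ?p M ?\<alpha> n] sets p by auto
  qed
  have "AE \<omega> in P'. 0 \<le> H \<bullet> X \<omega>" if "AE \<omega> in ?R. 0 \<le> H \<bullet> X \<omega>" and "P' \<in> PP" for H P'
  proof -
    have "H \<notin> U P''" if "P'' \<in> D" for P''
      using AE_absolutely_continuous[OF dom] \<open>AE \<omega> in ?R. 0 \<le> H \<bullet> X \<omega>\<close> that D(2) sets[of P'']
      by (auto simp: U_def E_def sets_mixture)
    then have "H \<notin> \<Union>(U ` PP)" using F(3) D(3) by auto
    then show ?thesis using \<open>P' \<in> PP\<close> by (auto simp: U_def)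
  qed
  with R dom show thesis using that[of ?R] by (auto simp: E_def)
qed

section \<open>The one-period fundamental theorem of asset pricing\<close>

text \<open>
  The vectors \<open>E[Z X]\<close> with \<open>0 < Z \<le> 1\<close> form a convex set. Were \<open>0\<close> outside it, some non-zero
  \<open>a\<close> in its span would satisfy \<open>E[Z (a \<bullet> X)] \<ge> 0\<close> for all these \<open>Z\<close>. Concentrating \<open>Z\<close> on
  the event where \<open>a \<bullet> X\<close> is negative shows \<open>a \<bullet> X \<ge> 0\<close>, so absence of arbitrage gives
  \<open>a \<bullet> X = 0\<close>. Then \<open>a\<close> is orthogonal to the convex set and also lies in its span, which forces
  \<open>a = 0\<close>. Choosing \<open>a\<close> in the span is what handles redundant assets, for which \<open>a \<bullet> X\<close> may
  vanish for a non-zero \<open>a\<close>.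
\<close>

lemma one_period_martingale_density:
  fixes X :: "'a \<Rightarrow> 'b::euclidean_space"
  assumes "integrable P X"
    and NA: "\<And>H. AE \<omega> in P. 0 \<le> H \<bullet> X \<omega> \<Longrightarrow> AE \<omega> in P. H \<bullet> X \<omega> = 0"
  obtains Z :: "'a \<Rightarrow> real" where "Z \<in> borel_measurable P" "\<And>\<omega>. 0 < Z \<omega>" "\<And>\<omega>. Z \<omega> \<le> 1"
    "(\<integral>\<omega>. Z \<omega> *\<^sub>R X \<omega> \<partial>P) = 0"
proof -
  note X = assms(1)
  define D where "D = {Z :: 'a \<Rightarrow> real. Z \<in> borel_measurable P \<and> (\<forall>\<omega>. 0 < Z \<omega> \<and> Z \<omega> \<le> 1)}"
  define K where "K = (\<lambda>Z. \<integral>\<omega>. Z \<omega> *\<^sub>R X \<omega> \<partial>P) ` D"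
  have int: "integrable P (\<lambda>\<omega>. Z \<omega> *\<^sub>R X \<omega>)" if "Z \<in> D" for Z
  proof (rule Bochner_Integration.integrable_bound[OF X])
    show "(\<lambda>\<omega>. Z \<omega> *\<^sub>R X \<omega>) \<in> borel_measurable P"
      using that X by (auto simp: D_def)
    show "AE \<omega> in P. norm (Z \<omega> *\<^sub>R X \<omega>) \<le> norm (X \<omega>)"
      using that by (auto simp: D_def mult_left_le_one_le less_imp_le)
  qed
  have "0 \<in> K"
  proof (rule ccontr)
    assume zero_K: "0 \<notin> K"
    have conv: "convex K"
    proof (rule convexI)
      fix x y and u v :: real
      assume "x \<in> K" "y \<in> K" and uv: "0 \<le> u" "0 \<le> v" "u + v = 1"
      then obtain Y Z where YZ: "Y \<in> D" "Z \<in> D"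
        and xy: "x = (\<integral>\<omega>. Y \<omega> *\<^sub>R X \<omega> \<partial>P)" "y = (\<integral>\<omega>. Z \<omega> *\<^sub>R X \<omega> \<partial>P)"
        by (auto simp: K_def)
      let ?W = "\<lambda>\<omega>. u * Y \<omega> + v * Z \<omega>"
      have W: "?W \<in> D"
      proof -
        have "0 < ?W \<omega> \<and> ?W \<omega> \<le> 1" for \<omega>
        proof
          have Y: "0 < Y \<omega>" "Y \<omega> \<le> 1" and Z: "0 < Z \<omega>" "Z \<omega> \<le> 1" using YZ by (auto simp: D_def)
          show "?W \<omega> \<le> 1" using convex_bound_le[OF Y(2) Z(2) uv] .
          have "0 < u \<or> 0 < v" using uv by linarith
          then show "0 < ?W \<omega>"
            using Y Z uv by (auto intro: add_pos_nonneg add_nonneg_pos)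
        qed
        then show ?thesis using YZ by (auto simp: D_def)
      qed
      have "(\<integral>\<omega>. ?W \<omega> *\<^sub>R X \<omega> \<partial>P) = u *\<^sub>R x + v *\<^sub>R y"
        using int[OF YZ(1)] int[OF YZ(2)]
        by (simp add: xy scaleR_add_left flip: scaleR_scaleR)
      then show "u *\<^sub>R x + v *\<^sub>R y \<in> K"
        unfolding K_def using W by (intro image_eqI[of _ _ ?W]) auto
    qed
    have "(\<lambda>_. 1) \<in> D" by (auto simp: D_def)
    then have "K \<noteq> {}" by (auto simp: K_def)
    then obtain a where a: "a \<in> span K" "a \<noteq> 0" "\<And>x. x \<in> K \<Longrightarrow> 0 \<le> a \<bullet> x"
      using separating_hyperplane_set_0_inspan[OF conv _ zero_K] by metis
    let ?f = "\<lambda>\<omega>. a \<bullet> X \<omega>"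
    have f: "integrable P ?f" using X by (rule integrable_inner_right)
    have aK: "a \<bullet> (\<integral>\<omega>. Z \<omega> *\<^sub>R X \<omega> \<partial>P) = (\<integral>\<omega>. Z \<omega> * ?f \<omega> \<partial>P)" if "Z \<in> D" for Z
      using integral_inner_right[OF int[OF that], of a] by simp
    have gain_nonneg: "0 \<le> (\<integral>\<omega>. Z \<omega> * ?f \<omega> \<partial>P)" if "Z \<in> D" for Z
    proof -
      have "(\<integral>\<omega>. Z \<omega> *\<^sub>R X \<omega> \<partial>P) \<in> K" unfolding K_def using that by (rule imageI)
      from a(3)[OF this] show ?thesis by (simp only: aK[OF that])
    qed
    have f': "integrable P (\<lambda>\<omega>. max 0 (?f \<omega>))" "integrable P (\<lambda>\<omega>. max 0 (- ?f \<omega>))"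
      using f by auto
    \<comment> \<open>A density that is \<open>1\<close> on the losses and \<open>e\<close> on the gains bounds the expected loss by
      \<open>e\<close> times the expected gain; it cannot be \<open>0\<close> on the gains since \<open>Z\<close> must be positive, so
      \<open>e\<close> is sent to \<open>0\<close> afterwards.\<close>
    have bound: "(\<integral>\<omega>. max 0 (- ?f \<omega>) \<partial>P) \<le> e * (\<integral>\<omega>. max 0 (?f \<omega>) \<partial>P)" if e: "0 < e" "e \<le> 1" for e
    proof -
      let ?Z = "\<lambda>\<omega>. if ?f \<omega> < 0 then 1 else e"
      have "?Z \<in> D" using e f by (auto simp: D_def)
      then have "0 \<le> (\<integral>\<omega>. ?Z \<omega> * ?f \<omega> \<partial>P)"
        by (rule gain_nonneg)
      also have "(\<lambda>\<omega>. ?Z \<omega> * ?f \<omega>) = (\<lambda>\<omega>. e * max 0 (?f \<omega>) - max 0 (- ?f \<omega>))"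
        by (auto simp: fun_eq_iff)
      finally show ?thesis using f' by simp
    qed
    have "(\<integral>\<omega>. max 0 (- ?f \<omega>) \<partial>P) \<le> 0"
    proof (rule tendsto_lowerbound)
      show "((\<lambda>e. e * (\<integral>\<omega>. max 0 (?f \<omega>) \<partial>P)) \<longlongrightarrow> 0) (at_right 0)"
        by (auto intro!: tendsto_eq_intros)
      show "\<forall>\<^sub>F e in at_right 0. (\<integral>\<omega>. max 0 (- ?f \<omega>) \<partial>P) \<le> e * (\<integral>\<omega>. max 0 (?f \<omega>) \<partial>P)"
        using eventually_at_right_real[of 0 1] bound by (auto elim!: eventually_mono)
    qed simp
    moreover have "0 \<le> (\<integral>\<omega>. max 0 (- ?f \<omega>) \<partial>P)" by simp
    ultimately have "AE \<omega> in P. max 0 (- ?f \<omega>) = 0"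
      using integral_nonneg_eq_0_iff_AE[OF f'(2)] by simp
    then have "AE \<omega> in P. 0 \<le> ?f \<omega>" by eventually_elim (auto simp: max_def split: if_splits)
    then have zero: "AE \<omega> in P. ?f \<omega> = 0" by (rule NA)
    have "orthogonal a x" if "x \<in> K" for x
    proof -
      from that obtain Z where Z: "Z \<in> D" "x = (\<integral>\<omega>. Z \<omega> *\<^sub>R X \<omega> \<partial>P)" by (auto simp: K_def)
      have "(\<integral>\<omega>. Z \<omega> * ?f \<omega> \<partial>P) = 0"
        using zero by (intro integral_eq_zero_AE) auto
      then show ?thesis using aK Z by (simp add: orthogonal_def)
    qed
    then have "orthogonal a a" using a(1) orthogonal_to_span by blast
    then show False using a(2) by (simp add: orthogonal_def)
  qed
  then show thesis using that by (auto simp: K_def D_def)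
qed

text \<open>
  The density found above is bounded and positive, so it can be normalised to a probability density
  without changing null sets.
\<close>

lemma ex_equivalent_martingale_measure:
  fixes X :: "'a \<Rightarrow> 'b::euclidean_space"
  assumes "prob_space P" and "integrable P X"
    and NA: "\<And>H. AE \<omega> in P. 0 \<le> H \<bullet> X \<omega> \<Longrightarrow> AE \<omega> in P. H \<bullet> X \<omega> = 0"
  obtains Q where "prob_space Q" "sets Q = sets P" "absolutely_continuous P Q"
    "absolutely_continuous Q P" "integrable Q X" "(\<integral>\<omega>. X \<omega> \<partial>Q) = 0"
proof -
  interpret prob_space P by fact
  obtain Z :: "'a \<Rightarrow> real" where Z: "Z \<in> borel_measurable P" "\<And>\<omega>. 0 < Z \<omega>" "\<And>\<omega>. Z \<omega> \<le> 1"
    and zero: "(\<integral>\<omega>. Z \<omega> *\<^sub>R X \<omega> \<partial>P) = 0"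
    using one_period_martingale_density[OF assms(2) NA] by blast
  have int: "integrable P Z"
    using Z by (intro integrable_const_bound[of _ 1]) (auto simp: abs_of_pos)
  define z where "z = (\<integral>\<omega>. Z \<omega> \<partial>P)"
  have "z \<noteq> 0"
  proof
    assume "z = 0"
    then have "AE \<omega> in P. Z \<omega> = 0"
      using integral_nonneg_eq_0_iff_AE[OF int] Z(2) by (simp add: z_def less_imp_le)
    then have "AE \<omega> in P. False"
    proof eventually_elim
      case (elim \<omega>)
      then show ?case using Z(2)[of \<omega>] by simp
    qed
    then show False by simp
  qed
  moreover have "0 \<le> z" unfolding z_def using Z(2) by (simp add: less_imp_le)
  ultimately have z: "0 < z" by simp
  let ?W = "\<lambda>\<omega>. Z \<omega> / z"
  have W: "?W \<in> borel_measurable P" "\<And>\<omega>. 0 < ?W \<omega>" using Z z by auto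
  let ?Q = "density P (\<lambda>\<omega>. ennreal (?W \<omega>))"
  have prob: "prob_space ?Q"
  proof (rule prob_spaceI)
    have "emeasure ?Q (space ?Q) = (\<integral>\<^sup>+\<omega>. ennreal (?W \<omega>) \<partial>P)"
      using W by (simp add: emeasure_density cong: nn_integral_cong)
    also have "\<dots> = ennreal (\<integral>\<omega>. ?W \<omega> \<partial>P)"
      using int W by (intro nn_integral_eq_integral) (auto simp: less_imp_le)
    also have "\<dots> = 1" using z by (simp add: z_def[symmetric])
    finally show "emeasure ?Q (space ?Q) = 1" .
  qed
  have "A \<in> null_sets ?Q \<longleftrightarrow> A \<in> null_sets P" for A
  proof -
    have "A \<in> null_sets ?Q \<longleftrightarrow> A \<in> sets P \<and> (AE \<omega> in P. \<omega> \<notin> A)"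
    proof (subst null_sets_density_iff)
      have "ennreal (?W \<omega>) \<noteq> 0" for \<omega> using W(2)[of \<omega>] by (simp add: ennreal_eq_0_iff)
      then show "(A \<in> sets P \<and> (AE \<omega> in P. \<omega> \<in> A \<longrightarrow> ennreal (?W \<omega>) = 0)) \<longleftrightarrow>
          A \<in> sets P \<and> (AE \<omega> in P. \<omega> \<notin> A)" by simp
    qed (use W in simp)
    then show ?thesis using AE_iff_null_sets[of A P] by auto
  qed
  then have null: "null_sets ?Q = null_sets P" by blast
  have W_eq: "(\<lambda>\<omega>. ?W \<omega> *\<^sub>R X \<omega>) = (\<lambda>\<omega>. (1 / z) *\<^sub>R (Z \<omega> *\<^sub>R X \<omega>))" by auto
  have XQ: "integrable P (\<lambda>\<omega>. Z \<omega> *\<^sub>R X \<omega>)"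
    using Z assms(2)
    by (intro Bochner_Integration.integrable_bound[OF assms(2)])
       (auto simp: mult_left_le_one_le less_imp_le abs_of_pos)
  have intQ: "integrable ?Q X"
    using W assms(2) XQ by (subst integrable_density) (auto simp: less_imp_le W_eq simp del: scaleR_scaleR)
  have "(\<integral>\<omega>. X \<omega> \<partial>?Q) = 0"
    using W assms(2) zero
    by (subst integral_density) (auto simp: less_imp_le W_eq simp del: scaleR_scaleR)
  then show thesis
    using that[OF prob _ _ _ intQ] by (simp add: absolutely_continuous_def null)
qed

section \<open>The equivalence\<close>

lemma increment_borel_measurable:
  assumes "S \<in> market_models M"
  shows "increment S \<in> borel_measurable M"
  using assms unfolding increment_def market_models_def by auto

lemma increment_integrable:
  assumes "S \<in> market_models M" "prob_space P" "sets P = sets M"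
  shows "integrable P (increment S)"
proof -
  interpret prob_space P by fact
  obtain B where B: "\<And>\<omega>. \<omega> \<in> space M \<Longrightarrow> norm (snd S \<omega>) \<le> B"
    using assms(1) by (fastforce simp: market_models_def bounded_iff)
  show ?thesis
  proof (rule integrable_const_bound[of _ "B + norm (fst S)"])
    show "AE \<omega> in P. norm (increment S \<omega>) \<le> B + norm (fst S)"
      using B sets_eq_imp_space_eq[OF assms(3)]
      by (intro AE_I2) (auto simp: increment_def intro: order_trans[OF norm_triangle_ineq4])
    show "increment S \<in> borel_measurable P"
      using increment_borel_measurable[OF assms(1)] assms(3) by (simp cong: measurable_cong_sets)
  qed
qed

lemma martingale_measures_iff:
  assumes "S \<in> market_models M"
  shows "Q \<in> martingale_measures M PP S \<longleftrightarrow>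
    Q \<in> prob_c M PP \<and> (\<integral>\<omega>. increment S \<omega> \<partial>Q) = 0"
proof -
  have "(\<integral>\<omega>. increment S \<omega> $ i \<partial>Q) = (\<integral>\<omega>. increment S \<omega> \<partial>Q) $ i" if "Q \<in> prob_c M PP" for i
  proof -
    have "integrable Q (increment S)"
      using that assms by (intro increment_integrable) (auto simp: prob_c_def space_prob_algebra)
    then show ?thesis
      using integral_inner_left[of "axis i 1" Q "increment S"] by (simp add: inner_axis)
  qed
  then show ?thesis by (auto simp: martingale_measures_def vec_eq_iff)
qed

theorem corollary4p38:
  fixes M :: "'a measure" and PP :: "'a measure set" and S :: "('a, 'd::finite) market"
  assumes "PP \<noteq> {}" and "PP \<subseteq> space (prob_algebra M)"
    and "\<forall>P\<in>PP. supported M PP P"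
    and "countably_convex M PP"
    and "S \<in> market_models M"
  shows "no_arbitrage M PP S \<longleftrightarrow>
    (\<forall>P\<in>PP. \<exists>Q\<in>equiv_martingale_measures M PP S. absolutely_continuous Q P)"
proof -
  let ?X = "increment S"
  have setsP: "sets P = sets M" and probP: "prob_space P" if "P \<in> PP" for P
    using assms(2) that by (auto simp: space_prob_algebra)
  note [measurable] = increment_borel_measurable[OF assms(5)]
  have qs_ge: "quasi_surely M PP (\<lambda>\<omega>. 0 \<le> H \<bullet> ?X \<omega>) \<longleftrightarrow> (\<forall>P\<in>PP. AE \<omega> in P. 0 \<le> H \<bullet> ?X \<omega>)"
    and qs_eq: "quasi_surely M PP (\<lambda>\<omega>. H \<bullet> ?X \<omega> = 0) \<longleftrightarrow> (\<forall>P\<in>PP. AE \<omega> in P. H \<bullet> ?X \<omega> = 0)" for H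
    by (rule quasi_surely_iff_AE[OF setsP]; measurable)+
  show ?thesis
  proof
    assume NA: "no_arbitrage M PP S"
    show "\<forall>P\<in>PP. \<exists>Q\<in>equiv_martingale_measures M PP S. absolutely_continuous Q P"
    proof
      fix P assume "P \<in> PP"
      then obtain R where R: "R \<in> PP" "absolutely_continuous R P"
        and cone: "\<And>H P'. AE \<omega> in R. 0 \<le> H \<bullet> ?X \<omega> \<Longrightarrow> P' \<in> PP \<Longrightarrow> AE \<omega> in P'. 0 \<le> H \<bullet> ?X \<omega>"
        using ex_dominating_measure[OF setsP assms(4)] by blast
      have "AE \<omega> in R. H \<bullet> ?X \<omega> = 0" if "AE \<omega> in R. 0 \<le> H \<bullet> ?X \<omega>" for H
        using NA cone[OF that] R(1) unfolding no_arbitrage_def qs_ge qs_eq by blast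
      then obtain Q where Q: "prob_space Q" "sets Q = sets R" "absolutely_continuous R Q"
          "absolutely_continuous Q R" "(\<integral>\<omega>. ?X \<omega> \<partial>Q) = 0"
        using ex_equivalent_martingale_measure[OF probP[OF R(1)]
            increment_integrable[OF assms(5) probP[OF R(1)] setsP[OF R(1)]]] by blast
      have "Q \<in> prob_c M PP"
        using Q R(1) setsP[OF R(1)]
        by (auto simp: prob_c_def space_prob_algebra polar_iff absolutely_continuous_def null_sets_def)
      then have "Q \<in> equiv_martingale_measures M PP S"
        using Q R(1) assms(5) by (auto simp: equiv_martingale_measures_def martingale_measures_iff)
      moreover have "absolutely_continuous Q P"
        using Q(4) R(2) by (auto simp: absolutely_continuous_def)
      ultimately show "\<exists>Q\<in>equiv_martingale_measures M PP S. absolutely_continuous Q P" by blast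
    qed
  next
    assume mm: "\<forall>P\<in>PP. \<exists>Q\<in>equiv_martingale_measures M PP S. absolutely_continuous Q P"
    show "no_arbitrage M PP S"
      unfolding no_arbitrage_def
    proof (intro allI impI)
      fix H assume H: "quasi_surely M PP (\<lambda>\<omega>. 0 \<le> H \<bullet> ?X \<omega>)"
      show "quasi_surely M PP (\<lambda>\<omega>. H \<bullet> ?X \<omega> = 0)"
        unfolding qs_eq
      proof
        fix P assume P: "P \<in> PP"
        then obtain Q R where Q: "Q \<in> prob_c M PP" "(\<integral>\<omega>. ?X \<omega> \<partial>Q) = 0"
          and ac: "R \<in> PP" "absolutely_continuous R Q" "absolutely_continuous Q P"
          using mm assms(5)
          by (auto simp: equiv_martingale_measures_def martingale_measures_iff)
        have Q': "prob_space Q" "sets Q = sets M"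
          using Q(1) by (auto simp: prob_c_def space_prob_algebra)
        have "AE \<omega> in Q. 0 \<le> H \<bullet> ?X \<omega>"
          using AE_absolutely_continuous[OF ac(2)] H ac(1) Q'(2) setsP[OF ac(1)]
          by (auto simp: qs_ge)
        moreover have int: "integrable Q ?X" by (rule increment_integrable[OF assms(5) Q'])
        then have "(\<integral>\<omega>. H \<bullet> ?X \<omega> \<partial>Q) = 0" using Q(2) integral_inner_right[OF int, of H] by simp
        ultimately have "AE \<omega> in Q. H \<bullet> ?X \<omega> = 0"
          using int by (subst (asm) integral_nonneg_eq_0_iff_AE) auto
        then show "AE \<omega> in P. H \<bullet> ?X \<omega> = 0"
          using AE_absolutely_continuous[OF ac(3)] Q'(2) setsP[OF P] by auto
      qed
    qed
  qed
qed

end
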